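(* Let $\bar{p}(N)$ be the number of partitions of $N$ with no parts of size $1$. For every $j\in \mathbb{N}$ and every integer $n\ge j+5$, $$PG(3n+2-j,2n-j)-PG(3(n-1)+2-j,2(n-1)-j)=\bar{p}(n+2).$$
   Context: A partition $\lambda=(\lambda_1\ge\cdots\ge\lambda_\ell)$ of $n$ is a finite nonincreasing sequence of positive integers with sum $n$; $\ell(\lambda)$ is its number of parts. The hook length $h_{(i,j)}(\lambda)$ of a cell $(i,j)$ of the Ferrers diagram is the number of cells consisting of the cell itself, the cells to its right in its row and the cells below it in its column. A numerical set is a subset $S\subseteq\mathbb{N}_0$ containing $0$ with finite complement; a numerical semigroup is a numerical set closed under addition. For a partition $\lambda$ let $S_\lambda=\mathbb{N}_0\setminus\{h_{(i,1)}(\lambda):1\le i\le\ell(\lambda)\}$. $PG(n,g)$ is the number of partitions $\lambda$ of $n$ with exactly $g$ parts such that $S_\lambda$ is a numerical semigroup. Here $\mathbb{N}$ is as written in the paper (which regards the cases $j=0,1,2$ as covered). *)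

theory Defs
  imports Main
begin

definition partition_of :: "nat list \<Rightarrow> nat \<Rightarrow> bool" where
  "partition_of p n \<longleftrightarrow> sorted_wrt (\<ge>) p \<and> (\<forall>k \<in> set p. k > 0) \<and> sum_list p = n"

text \<open>Cells \<open>(i, j)\<close> (row, column) are numbered from 1; row \<open>i\<close> has length \<open>p ! (i - 1)\<close>.\<close>

definition ferrers :: "nat list \<Rightarrow> (nat \<times> nat) set" where
  "ferrers p = {(i, j). 1 \<le> i \<and> i \<le> length p \<and> 1 \<le> j \<and> j \<le> p ! (i - 1)}"

definition hook :: "nat list \<Rightarrow> nat \<times> nat \<Rightarrow> (nat \<times> nat) set" where
  "hook p = (\<lambda>(i, j). {(i', j') \<in> ferrers p. (i' = i \<and> j \<le> j') \<or> (j' = j \<and> i \<le> i')})"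

definition hook_length :: "nat list \<Rightarrow> nat \<times> nat \<Rightarrow> nat" where
  "hook_length p c = card (hook p c)"

definition numerical_set :: "nat set \<Rightarrow> bool" where
  "numerical_set S \<longleftrightarrow> 0 \<in> S \<and> finite (- S)"

definition numerical_semigroup :: "nat set \<Rightarrow> bool" where
  "numerical_semigroup S \<longleftrightarrow> numerical_set S \<and> (\<forall>x \<in> S. \<forall>y \<in> S. x + y \<in> S)"

definition S_of :: "nat list \<Rightarrow> nat set" where
  "S_of p = UNIV - {hook_length p (i, 1) | i. 1 \<le> i \<and> i \<le> length p}"

definition PG :: "nat \<Rightarrow> nat \<Rightarrow> nat" where
  "PG n g = card {p. partition_of p n \<and> length p = g \<and> numerical_semigroup (S_of p)}"

definition pbar :: "nat \<Rightarrow> nat" where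
  "pbar N = card {p. partition_of p N \<and> 1 \<notin> set p}"

text \<open>The sets whose cardinalities are taken above are finite, so \<open>card\<close> is a genuine count.\<close>

lemma finite_partitions: "finite {p. partition_of p n}"
proof -
  have len: "length xs \<le> sum_list xs" if "\<forall>k \<in> set xs. k > 0" for xs :: "nat list"
    using that by (induction xs) (auto simp: Suc_le_eq)
  have "{p. partition_of p n} \<subseteq> {xs. set xs \<subseteq> {..n} \<and> length xs \<le> n}"
    using len member_le_sum_list by (fastforce simp: partition_of_def)
  then show ?thesis
    by (rule finite_subset) (rule finite_lists_length_le, simp)
qed

lemma finite_ferrers: "finite (ferrers p)"
proof -
  have "ferrers p \<subseteq> (\<Union>i \<in> {1..length p}. {i} \<times> {1..p ! (i - 1)})"
    by (auto simp: ferrers_def)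
  then show ?thesis
    by (rule finite_subset) auto
qed

end

theory Submission
  imports Defs
begin

text \<open>
  Removing the first column of a partition of \<open>w + g\<close> with \<open>g\<close> parts leaves a partition \<open>q\<close> of
  \<open>w\<close> with \<open>r \<le> g\<close> parts. With \<open>m = g - r + 1\<close> and \<open>H\<close> the set of first-column hook lengths of
  \<open>q\<close>, the set attached to the original partition is \<open>{0} \<union> (m + T)\<close>, where \<open>T = \<nat> - H\<close>. It is a
  semigroup iff no \<open>h \<in> H\<close> has the form \<open>m + t + t'\<close> with \<open>t, t' \<in> T\<close>. If \<open>1 \<le> t < h\<close> with
  \<open>t \<notin> H\<close> and \<open>h \<in> H\<close>, then \<open>h - t \<le> w - r\<close>; so for \<open>w < g\<close> the only possible violation is
  \<open>t = t' = 0\<close>, and the semigroup condition reduces to \<open>m \<notin> H\<close>.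

  Appending a part \<open>1\<close> to \<open>q\<close> shifts \<open>H\<close> by one and adds the hook \<open>1\<close>, so it turns the
  condition for \<open>(w - 1, g - 2)\<close> into the one for \<open>(w, g)\<close>. If \<open>q\<close> has no part \<open>1\<close>, all its hooks
  are at most \<open>w - r + 1 < m\<close> and the condition holds automatically. This yields the term
  \<open>pbar w\<close>; the theorem is the case \<open>w = n + 2\<close>, \<open>g = 2n - j\<close>.
\<close>

section \<open>First-column hook lengths\<close>

text \<open>These are the beta-numbers of the partition. Recursion from the top row suits induction:
  deleting that row leaves the hooks of the lower rows unchanged.\<close>

fun col_hooks :: "nat list \<Rightarrow> nat set" where
  "col_hooks [] = {}"
| "col_hooks (x # xs) = insert (x + length xs) (col_hooks xs)"

lemma col_hooks_nth: "col_hooks p = {p ! i + (length p - Suc i) | i. i < length p}"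
proof (induction p)
  case (Cons x xs)
  have "{(x # xs) ! i + (length (x # xs) - Suc i) | i. i < length (x # xs)}
      = insert (x + length xs) {xs ! i + (length xs - Suc i) | i. i < length xs}"
    (is "?L = ?R")
  proof (intro set_eqI iffI)
    fix h assume "h \<in> ?L"
    then obtain i where "i < length (x # xs)"
      and "h = (x # xs) ! i + (length (x # xs) - Suc i)" by blast
    then show "h \<in> ?R"
      by (cases i) (simp, intro insertI2 CollectI exI[of _ "i - 1"], simp)
  next
    fix h assume "h \<in> ?R"
    then consider "h = x + length xs"
      | i where "i < length xs" "h = xs ! i + (length xs - Suc i)" by blast
    then show "h \<in> ?L"
    proof cases
      case 1
      then show ?thesis by (intro CollectI exI[of _ 0]) simp
    next
      case 2
      then show ?thesis by (intro CollectI exI[of _ "Suc i"]) simp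
    qed
  qed
  with Cons show ?case by simp
qed simp

text \<open>The hook consists of row \<open>i\<close> and the first cells of the rows below it;
  positivity of the parts puts those cells in the diagram.\<close>

lemma hook_length_col:
  assumes pos: "\<forall>k \<in> set p. k > 0" and i: "1 \<le> i" "i \<le> length p"
  shows "hook_length p (i, 1) = p ! (i - 1) + (length p - i)"
proof -
  have pos': "1 \<le> p ! (k - 1)" if "1 \<le> k" "k \<le> length p" for k
    using pos that by (auto simp: Suc_le_eq)
  have "hook p (i, 1) = ({i} \<times> {1..p ! (i - 1)}) \<union> ({i<..length p} \<times> {1})"
    using i pos' by (auto simp: hook_def ferrers_def)
  moreover have "card (({i} \<times> {1..p ! (i - 1)}) \<union> ({i<..length p} \<times> {1::nat}))
      = p ! (i - 1) + (length p - i)"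
    by (subst card_Un_disjoint) (auto simp: card_cartesian_product)
  ultimately show ?thesis by (simp add: hook_length_def)
qed

lemma S_of_eq:
  assumes "\<forall>k \<in> set p. k > 0"
  shows "S_of p = - col_hooks p"
proof -
  have "{hook_length p (i, 1) | i. 1 \<le> i \<and> i \<le> length p}
      = {p ! i + (length p - Suc i) | i. i < length p}" (is "?L = ?R")
  proof (intro set_eqI iffI)
    fix h assume "h \<in> ?L"
    then obtain i where i: "1 \<le> i" "i \<le> length p" "h = hook_length p (i, 1)" by blast
    then show "h \<in> ?R"
      using hook_length_col[OF assms i(1,2)]
      by (intro CollectI exI[of _ "i - 1"]) auto
  next
    fix h assume "h \<in> ?R"
    then obtain i where i: "i < length p" "h = p ! i + (length p - Suc i)" by blast
    then show "h \<in> ?L"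
      using hook_length_col[OF assms, of "Suc i"]
      by (intro CollectI exI[of _ "Suc i"]) auto
  qed
  then show ?thesis by (auto simp: S_of_def col_hooks_nth)
qed

lemma finite_col_hooks: "finite (col_hooks p)"
  by (induction p) auto

lemma col_hooks_pos: "\<forall>k \<in> set p. k > 0 \<Longrightarrow> 0 \<notin> col_hooks p"
  by (induction p) auto

lemma col_hooks_replicate_1: "col_hooks (replicate z 1) = {1..z}"
  by (induction z) auto

lemma col_hooks_snoc_1: "col_hooks (q @ [1]) = insert 1 (Suc ` col_hooks q)"
  by (induction q) auto

lemma length_le_sum_list: "\<forall>k \<in> set xs. k > 0 \<Longrightarrow> length xs \<le> sum_list (xs :: nat list)"
  by (induction xs) (auto simp: Suc_le_eq)

lemma sum_list_le_length: "\<forall>k \<in> set xs. k \<le> 1 \<Longrightarrow> sum_list (xs :: nat list) \<le> length xs"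
  by (induction xs) auto

section \<open>Distance from a non-hook up to a hook\<close>

text \<open>Induction on rows: a top part of at least 2 covers the increase on the left. A top part
  1 forces all parts to be 1.\<close>

lemma non_hook_lower_bound:
  assumes "sorted_wrt (\<ge>) q" "\<forall>k \<in> set q. k > 0" "y \<notin> col_hooks q" "y \<ge> 1"
  shows "2 * length q + 1 \<le> y + sum_list q"
  using assms
proof (induction q)
  case (Cons x xs)
  then have IH: "2 * length xs + 1 \<le> y + sum_list xs" and "x > 0" by auto
  consider "x \<ge> 2" | "x = 1" using \<open>x > 0\<close> by linarith
  then show ?case
  proof cases
    case 1
    with IH show ?thesis by simp
  next
    case 2
    with Cons.prems have "sum_list xs \<le> length xs"
      by (intro sum_list_le_length) auto
    moreover have "length xs \<le> sum_list xs"
      using Cons.prems by (intro length_le_sum_list) auto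
    \<comment> \<open>\<open>IH\<close> gives \<open>y \<ge> length xs + 1\<close>; equality is
      excluded because that number is the hook of the top row.\<close>
    ultimately show ?thesis using Cons.prems IH 2 by auto
  qed
qed simp

text \<open>Rows above the one carrying \<open>h\<close> only weaken the bound, since each part is
  at least 1. For \<open>h\<close> in the top row, the preceding bound applies to the rows
  below.\<close>

lemma hook_minus_non_hook_le:
  assumes "sorted_wrt (\<ge>) q" "\<forall>k \<in> set q. k > 0"
    and "y \<notin> col_hooks q" "y \<ge> 1" "h \<in> col_hooks q"
  shows "h + length q \<le> sum_list q + y"
  using assms
proof (induction q)
  case (Cons x xs)
  show ?case
  proof (cases "h \<in> col_hooks xs")
    case True
    with Cons show ?thesis by auto
  next
    case False
    then have "h = x + length xs" using Cons.prems by auto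
    moreover have "2 * length xs + 1 \<le> y + sum_list xs"
      using Cons.prems by (intro non_hook_lower_bound) auto
    ultimately show ?thesis by simp
  qed
qed simp

section \<open>Adding a first column and the semigroup condition\<close>

definition add_col :: "nat \<Rightarrow> nat list \<Rightarrow> nat list" where
  "add_col g q = map Suc q @ replicate (g - length q) 1"

text \<open>Each old row gains one cell and has \<open>z\<close> further rows below it, hence the
  shift by \<open>z + 1\<close>.\<close>

lemma col_hooks_add_col:
  "col_hooks (map Suc q @ replicate z 1) = {1..z} \<union> (\<lambda>h. z + 1 + h) ` col_hooks q"
proof (induction q)
  case Nil
  then show ?case using col_hooks_replicate_1 by simp
qed (auto simp: algebra_simps)

text \<open>Two nonzero elements \<open>z + 1 + t\<close> and \<open>z + 1 + t'\<close> add up to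
  \<open>z + 1\<close> plus \<open>z + 1 + t + t'\<close>, so closure is a condition on the
  latter.\<close>

lemma numerical_semigroup_shift:
  fixes H :: "nat set"
  assumes "finite H"
  shows "numerical_semigroup (- ({1..z} \<union> (\<lambda>h. z + 1 + h) ` H)) \<longleftrightarrow>
    (\<forall>t t'. t \<notin> H \<longrightarrow> t' \<notin> H \<longrightarrow> z + 1 + t + t' \<notin> H)" (is "numerical_semigroup ?S \<longleftrightarrow> ?R")
proof -
  have mem: "x \<in> ?S \<longleftrightarrow> x = 0 \<or> (\<exists>t. t \<notin> H \<and> x = z + 1 + t)" for x
  proof (cases "x \<le> z")
    case True
    then show ?thesis by auto
  next
    case False
    then obtain t where "x = z + 1 + t" using less_iff_Suc_add[of z x] by auto
    then show ?thesis by auto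
  qed
  have shift: "z + 1 + t \<in> ?S \<longleftrightarrow> t \<notin> H" for t
    unfolding mem by auto
  have "numerical_set ?S" using assms by (auto simp: numerical_set_def)
  then have "numerical_semigroup ?S \<longleftrightarrow> (\<forall>x \<in> ?S. \<forall>y \<in> ?S. x + y \<in> ?S)"
    by (simp only: numerical_semigroup_def simp_thms)
  also have "\<dots> \<longleftrightarrow> ?R"
  proof
    assume closed: "\<forall>x \<in> ?S. \<forall>y \<in> ?S. x + y \<in> ?S"
    show ?R
    proof (intro allI impI)
      fix t t' assume "t \<notin> H" "t' \<notin> H"
      then have "(z + 1 + t) + (z + 1 + t') \<in> ?S" using closed shift by blast
      then have "z + 1 + (z + 1 + t + t') \<in> ?S" by (simp only: ac_simps)
      then show "z + 1 + t + t' \<notin> H" using shift by blast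
    qed
  next
    assume R: ?R
    show "\<forall>x \<in> ?S. \<forall>y \<in> ?S. x + y \<in> ?S"
    proof (intro ballI)
      fix x y assume x: "x \<in> ?S" and y: "y \<in> ?S"
      show "x + y \<in> ?S"
      proof (cases "x = 0 \<or> y = 0")
        case True
        with x y show ?thesis by (metis add_0 add_0_right)
      next
        case False
        with x y obtain t t' where t: "t \<notin> H" "x = z + 1 + t" "t' \<notin> H" "y = z + 1 + t'"
          unfolding mem by blast
        then have "z + 1 + (z + 1 + t + t') \<in> ?S" using R shift by blast
        moreover have "x + y = z + 1 + (z + 1 + t + t')" using t by simp
        ultimately show ?thesis by (simp only:)
      qed
    qed
  qed
  finally show ?thesis .
qed

lemma numerical_semigroup_add_col:
  assumes q: "partition_of q w" and "w < g"
  shows "numerical_semigroup (S_of (add_col g q)) \<longleftrightarrow> g + 1 - length q \<notin> col_hooks q"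
proof -
  have srt: "sorted_wrt (\<ge>) q" and pos: "\<forall>k \<in> set q. k > 0" and sum: "sum_list q = w"
    using q by (auto simp: partition_of_def)
  have len: "length q \<le> w" using length_le_sum_list[OF pos] sum by simp
  define z where "z = g - length q"
  have z: "w < z + length q" "g + 1 - length q = z + 1" using len \<open>w < g\<close> by (auto simp: z_def)
  have "S_of (add_col g q) = - ({1..z} \<union> (\<lambda>h. z + 1 + h) ` col_hooks q)"
    unfolding add_col_def z_def[symmetric]
    by (subst S_of_eq) (auto simp only: col_hooks_add_col set_append set_map set_replicate_conv_if
        split: if_splits)
  then have "numerical_semigroup (S_of (add_col g q)) \<longleftrightarrow>
    (\<forall>t t'. t \<notin> col_hooks q \<longrightarrow> t' \<notin> col_hooks q \<longrightarrow> z + 1 + t + t' \<notin> col_hooks q)"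
    using numerical_semigroup_shift[OF finite_col_hooks] by metis
  also have "\<dots> \<longleftrightarrow> z + 1 \<notin> col_hooks q"
  proof
    assume "\<forall>t t'. t \<notin> col_hooks q \<longrightarrow> t' \<notin> col_hooks q \<longrightarrow> z + 1 + t + t' \<notin> col_hooks q"
    \<comment> \<open>As 0 is never a hook, \<open>t = t' = 0\<close> is admissible.\<close>
    then show "z + 1 \<notin> col_hooks q" using col_hooks_pos[OF pos] by (metis add_0_right)
  next
    assume z1: "z + 1 \<notin> col_hooks q"
    \<comment> \<open>A hook exceeds a positive non-hook \<open>t\<close> by at most
      \<open>w - length q\<close>, which is less than \<open>z\<close>.\<close>
    have small: "z + 1 + t + t' \<notin> col_hooks q" if "t \<notin> col_hooks q" "t \<ge> 1" for t t'
      using hook_minus_non_hook_le[OF srt pos that, of "z + 1 + t + t'"] z sum by auto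
    show "\<forall>t t'. t \<notin> col_hooks q \<longrightarrow> t' \<notin> col_hooks q \<longrightarrow> z + 1 + t + t' \<notin> col_hooks q"
    proof (intro allI impI)
      fix t t' assume t: "t \<notin> col_hooks q" "t' \<notin> col_hooks q"
      consider "t \<ge> 1" | "t' \<ge> 1" | "t = 0" "t' = 0" by linarith
      then show "z + 1 + t + t' \<notin> col_hooks q"
      proof cases
        case 2
        then show ?thesis using small[OF t(2), of t] by (simp add: ac_simps)
      qed (use small t z1 in auto)
    qed
  qed
  finally show ?thesis using z by simp
qed

section \<open>Bijection given by removing the first column\<close>

lemma partition_of_add_col:
  assumes "partition_of q w" "length q \<le> g"
  shows "partition_of (add_col g q) (g + w)" "length (add_col g q) = g"
proof -
  have "sum_list (map Suc q) = length q + sum_list q" by (induction q) auto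
  moreover have "sorted_wrt (\<ge>) (replicate k (1::nat))" for k by (induction k) auto
  ultimately show "partition_of (add_col g q) (g + w)" "length (add_col g q) = g"
    using assms
    by (auto simp: partition_of_def add_col_def sorted_wrt_append sorted_wrt_map
        sum_list_replicate)
qed

text \<open>The old rows are recovered as those of length above 1, each shortened by one
  cell.\<close>

lemma inj_on_add_col: "inj_on (add_col g) {q. partition_of q w}"
proof (rule inj_on_inverseI)
  fix q assume "q \<in> {q. partition_of q w}"
  then have "\<forall>k \<in> set q. k > 0" by (simp add: partition_of_def)
  then have "filter ((<) 1) (map Suc q) = map Suc q" by (auto simp: filter_id_conv)
  then show "map (\<lambda>x. x - 1) (filter ((<) 1) (add_col g q)) = q"
    by (simp add: add_col_def comp_def)
qed

lemma obtain_add_col: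
  assumes "sorted_wrt (\<ge>) p" "\<forall>k \<in> set p. k > (0::nat)"
  shows "\<exists>q. sorted_wrt (\<ge>) q \<and> (\<forall>k \<in> set q. k > 0) \<and> length q \<le> length p
    \<and> p = add_col (length p) q"
  using assms
proof (induction p)
  case Nil
  then show ?case by (auto simp: add_col_def)
next
  case (Cons x xs)
  then obtain q where q: "sorted_wrt (\<ge>) q" "\<forall>k \<in> set q. k > 0" "length q \<le> length xs"
    "xs = add_col (length xs) q" by auto
  show ?case
  proof (cases "x = 1")
    case True
    then have "\<forall>k \<in> set (x # xs). k = 1"
      using Cons.prems by (auto simp: le_antisym Suc_le_eq)
    then have "x # xs = replicate (length (x # xs)) 1"
      by (metis replicate_eqI)
    \<comment> \<open>The whole diagram is a single column, so nothing remains.\<close>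
    then show ?thesis by (intro exI[of _ "[]"]) (simp add: add_col_def)
  next
    case False
    have "set (map Suc q) \<subseteq> set xs" by (subst q(4)) (auto simp: add_col_def)
    then have le: "\<forall>k \<in> set q. k \<le> x - 1" using Cons.prems by fastforce
    have x: "x - 1 > 0" using Cons.prems False by (cases x) auto
    \<comment> \<open>Both lists grow by one row, so the number of appended ones stays the
      same.\<close>
    then have eq: "x # xs = add_col (length (x # xs)) ((x - 1) # q)"
      using q(4) by (simp add: add_col_def)
    show ?thesis
    proof (intro exI conjI)
      show "x # xs = add_col (length (x # xs)) ((x - 1) # q)" by (fact eq)
    qed (use q(1-3) le x in auto)
  qed
qed

lemma add_col_image:
  "add_col g ` {q. partition_of q w \<and> length q \<le> g} = {p. partition_of p (g + w) \<and> length p = g}"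
proof (intro set_eqI iffI)
  fix p assume "p \<in> add_col g ` {q. partition_of q w \<and> length q \<le> g}"
  then show "p \<in> {p. partition_of p (g + w) \<and> length p = g}"
    using partition_of_add_col by auto
next
  fix p assume p: "p \<in> {p. partition_of p (g + w) \<and> length p = g}"
  then obtain q where q: "sorted_wrt (\<ge>) q" "\<forall>k \<in> set q. k > 0" "length q \<le> g" "p = add_col g q"
    using obtain_add_col[of p] by (auto simp: partition_of_def)
  have qs: "partition_of q (sum_list q)" using q by (simp add: partition_of_def)
  have "g + sum_list q = g + w"
    using partition_of_add_col(1)[OF qs q(3)] p q(4) by (auto simp: partition_of_def)
  then show "p \<in> add_col g ` {q. partition_of q w \<and> length q \<le> g}"
    using q qs by auto
qed

lemma partition_length_le: "partition_of q w \<Longrightarrow> length q \<le> w"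
  using length_le_sum_list by (auto simp: partition_of_def)

text \<open>The restriction \<open>length q \<le> g\<close> of the bijection disappears because
  \<open>length q \<le> w < g\<close>.\<close>

lemma PG_small_weight:
  assumes "w < g"
  shows "PG (g + w) g = card {q. partition_of q w \<and> g + 1 - length q \<notin> col_hooks q}"
proof -
  let ?Q = "{q. partition_of q w \<and> g + 1 - length q \<notin> col_hooks q}"
  have "{p. partition_of p (g + w) \<and> length p = g \<and> numerical_semigroup (S_of p)}
      = {p \<in> add_col g ` {q. partition_of q w \<and> length q \<le> g}. numerical_semigroup (S_of p)}"
    unfolding add_col_image by auto
  also have "\<dots> = add_col g ` ?Q"
    using numerical_semigroup_add_col[OF _ assms] partition_length_le[of _ w] assms
    by (fastforce simp: image_iff)
  finally show ?thesis
    unfolding PG_def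
    using card_image[OF inj_on_subset[OF inj_on_add_col[of g w], of ?Q]] by auto
qed

section \<open>Splitting by the presence of a part 1\<close>

lemma partition_of_snoc_1: "partition_of (q @ [1]) (Suc w) \<longleftrightarrow> partition_of q w"
  by (auto simp: partition_of_def sorted_wrt_append Suc_le_eq)

lemma partition_with_1_snoc:
  assumes "partition_of q w" "1 \<in> set q"
  obtains q' where "q = q' @ [1]"
proof (cases q rule: rev_cases)
  case Nil
  with assms show ?thesis by simp
next
  case (snoc ys y)
  then have "y > 0" "\<forall>x \<in> set ys. y \<le> x"
    using assms by (auto simp: partition_of_def sorted_wrt_append)
  then have "y = 1" using assms(2) snoc by (auto simp: le_antisym Suc_le_eq)
  with snoc that show ?thesis by simp
qed

text \<open>For the top row \<open>x\<close>, \<open>x + 2 * length xs\<close> is at most the total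
  sum, as all parts are at least 2; lower rows follow by induction.\<close>

lemma col_hooks_no_1_le:
  assumes "partition_of q w" "1 \<notin> set q" "h \<in> col_hooks q"
  shows "h + length q \<le> w + 1"
proof -
  have "\<forall>k \<in> set q. k \<ge> 2"
    using assms by (metis One_nat_def Suc_1 Suc_leI le_neq_implies_less partition_of_def)
  then have "h + length q \<le> sum_list q + 1" using assms(3)
  proof (induction q)
    case (Cons x xs)
    have "2 * length xs \<le> sum_list xs"
      using Cons.prems(1) by (induction xs) auto
    with Cons show ?case by auto
  qed simp
  with assms show ?thesis by (simp add: partition_of_def)
qed

lemma PG_recurrence:
  assumes "Suc w < g"
  shows "PG (g + 2 + Suc w) (g + 2) = PG (g + w) g + pbar (Suc w)"
proof -
  let ?A = "{q. partition_of q w \<and> g + 1 - length q \<notin> col_hooks q}"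
  let ?B = "{q. partition_of q (Suc w) \<and> 1 \<notin> set q}"
  let ?C = "{q. partition_of q (Suc w) \<and> g + 2 + 1 - length q \<notin> col_hooks q}"
  have step: "q @ [1] \<in> ?C \<longleftrightarrow> q \<in> ?A" for q
  proof (cases "partition_of q w")
    case True
    then have "length q \<le> w" by (rule partition_length_le)
    \<comment> \<open>Positivity keeps the shifted value distinct from the new hook 1.\<close>
    then have "g + 2 + 1 - length (q @ [1]) = Suc (g + 1 - length q)" "g + 1 - length q > 0"
      using assms by auto
    then have "g + 2 + 1 - length (q @ [1]) \<in> col_hooks (q @ [1]) \<longleftrightarrow>
        g + 1 - length q \<in> col_hooks q"
      unfolding col_hooks_snoc_1 by auto
    then show ?thesis using partition_of_snoc_1 by blast
  next
    case False
    then show ?thesis using partition_of_snoc_1 by blast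
  qed
  \<comment> \<open>Here every hook is at most \<open>w + 2 - length q\<close>, below
    \<open>g + 3 - length q\<close>.\<close>
  have "?B \<subseteq> ?C" using col_hooks_no_1_le assms by fastforce
  have "?C = (\<lambda>q. q @ [1]) ` ?A \<union> ?B"
  proof (intro subset_antisym subsetI)
    fix q assume q: "q \<in> ?C"
    show "q \<in> (\<lambda>q. q @ [1]) ` ?A \<union> ?B"
    proof (cases "1 \<in> set q")
      case True
      then obtain q' where "q = q' @ [1]" using q partition_with_1_snoc by blast
      then show ?thesis using q step by blast
    qed (use q in blast)
  next
    fix q assume "q \<in> (\<lambda>q. q @ [1]) ` ?A \<union> ?B"
    then show "q \<in> ?C" using step \<open>?B \<subseteq> ?C\<close> by blast
  qed
  moreover have "(\<lambda>q. q @ [1]) ` ?A \<inter> ?B = {}" by auto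
  moreover have "finite ?A" "finite ?B"
    using finite_partitions[of w] finite_partitions[of "Suc w"] by (auto elim: rev_finite_subset)
  ultimately have "card ?C = card ?A + card ?B"
    by (simp add: card_Un_disjoint card_image inj_on_def)
  then show ?thesis
    using PG_small_weight[of w g] PG_small_weight[of "Suc w" "g + 2"] assms
    by (simp add: pbar_def)
qed

theorem theorem3p6:
  fixes j n :: nat
  assumes "n \<ge> j + 5"
  shows "int (PG (3 * n + 2 - j) (2 * n - j)) - int (PG (3 * (n - 1) + 2 - j) (2 * (n - 1) - j))
    = int (pbar (n + 2))"
proof -
  \<comment> \<open>\<open>g\<close> is the smaller number of parts, leaving weights
    \<open>n + 1\<close> and \<open>n + 2\<close> outside the first column. The bound
    \<open>n + 2 < g\<close> amounts to \<open>n \<ge> j + 5\<close>.\<close>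
  define g where "g = 2 * (n - 1) - j"
  have "3 * n + 2 - j = g + 2 + Suc (n + 1)" "2 * n - j = g + 2"
    "3 * (n - 1) + 2 - j = g + (n + 1)" "Suc (n + 1) < g" "n + 2 = Suc (n + 1)"
    using assms by (auto simp: g_def)
  then show ?thesis
    using PG_recurrence[of "n + 1" g] by (simp only: g_def[symmetric] of_nat_add add_diff_cancel_left')
qed

end
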